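(* Suppose $X$ is Hausdorff, let $\Omega$ be any topological space, and let $T_0$ be a finite subset of $\Omega$. (a) Let $V,V'$ be two Nachbin families on $\Omega$ such that $V'\subset C(\Omega,\mathbb{R}_+)$ and $V\le V'$. Then for every $f\in C_0(\Omega,X)\cap CV'_0(\Omega,X)$, $\varepsilon>0$, $v\in V$ and $p\in\mathcal{A}$, there is $u\in C_c(\Omega,\mathbb{C})\otimes X\subset CV_0(\Omega,X)$ such that $|f-u|_{v,p}<\varepsilon$, $u|_{T_0}=f|_{T_0}$, $u(\Omega)\subset co(f(\Omega)\cup\{0\})$, and $\operatorname{supp} u\subset\operatorname{supp} f$. In particular, this applies to every $f\in C_0(\Omega,X)$ with the uniform topology, i.e. with $V=\{1\}$. (b) For every $f\in C_b(\Omega,X)$, $\varepsilon>0$, $v\in C_0(\Omega,\mathbb{R}_+)$ and $p\in\mathcal{A}$, there is $u\in C_b(\Omega,\mathbb{C})\otimes X$ such that $|f-u|_{v,p}<\varepsilon$, $u|_{T_0}=f|_{T_0}$, $u(\Omega)\subset co(f(\Omega))$, and $\operatorname{supp} u\subset\operatorname{supp} f$.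
   Context: $\Omega$ need not be Hausdorff. $X$ is a complex locally convex topological vector space whose topology is given by a family $\mathcal{A}$ of seminorms. A Nachbin family is a set of upper semicontinuous functions $\Omega\to\mathbb{R}_+=[0,\infty)$. For two Nachbin families, $V\le V'$ means that for every $v\in V$ there is $v'\in V'$ with $v\le v'$ pointwise. $C(\Omega,X)$ is the set of continuous maps $\Omega\to X$; $C_b(\Omega,X)$ is the subset of bounded ones (each $p\circ f$, $p\in\mathcal{A}$, bounded); $C_0(\Omega,X)$ is the set of $f\in C(\Omega,X)$ such that $\{x:p(f(x))\ge\epsilon\}$ is compact for all $p\in\mathcal{A}$, $\epsilon>0$; $C_0(\Omega,\mathbb{R}_+)$ is the set of continuous $v:\Omega\to[0,\infty)$ with $\{x:v(x)\ge\epsilon\}$ compact for all $\epsilon>0$. $\operatorname{supp} f$ is the closure of $\{x:f(x)\ne0\}$; $C_c(\Omega,X)$ is the set of $f\in C(\Omega,X)$ with compact support. For a Nachbin family $V$, $CV_0(\Omega,X)$ is the set of $f\in C(\Omega,X)$ such that for all $v\in V$, $p\in\mathcal{A}$, $\epsilon>0$ the set $\{x\in\Omega:v(x)p(f(x))\ge\epsilon\}$ is compact; $CV'_0(\Omega,X)$ is the same space for the family $V'$. Put $|f|_{v,p}=\sup_{x\in\Omega}v(x)p(f(x))$. For $A\subset C(\Omega,\mathbb{C})$, $A\otimes X$ is the linear span of the functions $t\mapsto\varphi(t)x$, $\varphi\in A$, $x\in X$. For $X_0\subset X$, $co(X_0)$ denotes the closed convex hull, i.e. the closure of the set of all finite convex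 combinations of elements of $X_0$. *)

theory Defs
  imports "HOL-Analysis.Analysis" "HOL-Library.Function_Algebras"
begin

text \<open>
  The libraries have no type class of complex topological vector spaces, so a complex vector space
  is a type of class \<open>ab_group_add\<close> together with a scalar multiplication
  \<open>smul :: complex \<Rightarrow> 'x \<Rightarrow> 'x\<close> satisfying the locale predicate \<open>vector_space\<close>.
  The space \<open>\<Omega>\<close> is an abstract topology, so functions on it are functions on the whole type of
  which only the values on \<open>topspace \<Omega>\<close> are relevant. The scalar field itself is the space
  with the single seminorm \<open>cmod\<close>.
\<close>

definition is_seminorm :: "(complex \<Rightarrow> 'x \<Rightarrow> 'x) \<Rightarrow> ('x::ab_group_add \<Rightarrow> real) \<Rightarrow> bool" where
  "is_seminorm smul p \<longleftrightarrow>
     (\<forall>x. 0 \<le> p x) \<and>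
     (\<forall>x y. p (x + y) \<le> p x + p y) \<and>
     (\<forall>c x. p (smul c x) = cmod c * p x)"

text \<open>The family \<open>\<A>\<close> is not assumed to be directed, hence the finite subfamilies.\<close>

definition seminorm_topology :: "('x::ab_group_add \<Rightarrow> real) set \<Rightarrow> 'x topology" where
  "seminorm_topology \<A> = topology (\<lambda>U. \<forall>x\<in>U. \<exists>F e. finite F \<and> F \<subseteq> \<A> \<and> 0 < e \<and>
     {y. \<forall>p\<in>F. p (y - x) < e} \<subseteq> U)"

lemma openin_seminorm_topology:
  "openin (seminorm_topology \<A>) U \<longleftrightarrow>
     (\<forall>x\<in>U. \<exists>F e. finite F \<and> F \<subseteq> \<A> \<and> 0 < e \<and> {y. \<forall>p\<in>F. p (y - x) < e} \<subseteq> U)"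
proof -
  let ?L = "\<lambda>U. \<forall>x\<in>U. \<exists>F e. finite F \<and> F \<subseteq> \<A> \<and> (0::real) < e \<and> {y. \<forall>p\<in>F. p (y - x) < e} \<subseteq> U"
  have int: "?L (S \<inter> T)" if S: "?L S" and T: "?L T" for S T
  proof
    fix x assume "x \<in> S \<inter> T"
    then have x: "x \<in> S" "x \<in> T"
      by simp_all
    from bspec[OF S x(1)] obtain F d where
      F: "finite F \<and> F \<subseteq> \<A> \<and> 0 < d \<and> {y. \<forall>p\<in>F. p (y - x) < d} \<subseteq> S"
      by iprover
    from bspec[OF T x(2)] obtain G e where
      G: "finite G \<and> G \<subseteq> \<A> \<and> 0 < e \<and> {y. \<forall>p\<in>G. p (y - x) < e} \<subseteq> T"
      by iprover
    have "{y. \<forall>p\<in>F \<union> G. p (y - x) < min d e} \<subseteq>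
        {y. \<forall>p\<in>F. p (y - x) < d} \<inter> {y. \<forall>p\<in>G. p (y - x) < e}"
      by auto
    also have "\<dots> \<subseteq> S \<inter> T"
      using F G by (intro Int_mono) simp_all
    finally show "\<exists>F e. finite F \<and> F \<subseteq> \<A> \<and> 0 < e \<and> {y. \<forall>p\<in>F. p (y - x) < e} \<subseteq> S \<inter> T"
      using F G by (intro exI[of _ "F \<union> G"] exI[of _ "min d e"] conjI) simp_all
  qed
  have un: "?L (\<Union>\<K>)" if \<K>: "\<forall>K\<in>\<K>. ?L K" for \<K>
  proof
    fix x assume "x \<in> \<Union>\<K>"
    then obtain K where K: "K \<in> \<K>" "x \<in> K"
      by (rule UnionE)
    from bspec[OF bspec[OF \<K> K(1)] K(2)] obtain F e where
      F: "finite F \<and> F \<subseteq> \<A> \<and> 0 < e \<and> {y. \<forall>p\<in>F. p (y - x) < e} \<subseteq> K"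
      by iprover
    then have "{y. \<forall>p\<in>F. p (y - x) < e} \<subseteq> \<Union>\<K>"
      using Union_upper[OF K(1)] by (elim conjE) (rule subset_trans)
    then show "\<exists>F e. finite F \<and> F \<subseteq> \<A> \<and> 0 < e \<and> {y. \<forall>p\<in>F. p (y - x) < e} \<subseteq> \<Union>\<K>"
      using F by (intro exI[of _ F] exI[of _ e] conjI) simp_all
  qed
  have "istopology ?L"
    unfolding istopology_def
  proof (intro conjI allI impI)
    fix S T assume "?L S" "?L T"
    then show "?L (S \<inter> T)"
      by (rule int)
  next
    fix \<K> assume "\<forall>K\<in>\<K>. ?L K"
    then show "?L (\<Union>\<K>)"
      by (rule un)
  qed
  then show ?thesis
    unfolding seminorm_topology_def by (subst topology_inverse') (assumption, rule refl)
qed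

lemma topspace_seminorm_topology [simp]: "topspace (seminorm_topology \<A>) = UNIV"
proof -
  have "openin (seminorm_topology \<A>) UNIV"
    unfolding openin_seminorm_topology by (intro ballI exI[of _ "{}"] exI[of _ 1]) simp
  then show ?thesis
    using openin_subset by blast
qed

lemma seminorm_topology_cmod: "seminorm_topology {cmod} = euclidean"
proof -
  have "openin (seminorm_topology {cmod}) U \<longleftrightarrow> open U" for U
  proof
    assume L: "openin (seminorm_topology {cmod}) U"
    show "open U"
      unfolding open_dist
    proof
      fix x assume "x \<in> U"
      from bspec[OF L[unfolded openin_seminorm_topology] this] obtain F e
        where "F \<subseteq> {cmod}" "(0::real) < e" and sub: "{y. \<forall>p\<in>F. p (y - x) < e} \<subseteq> U"
        by iprover
      then have "y \<in> U" if "dist y x < e" for y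
        using that by (intro subsetD[OF sub]) (auto simp: dist_norm)
      with \<open>0 < e\<close> show "\<exists>e>0. \<forall>y. dist y x < e \<longrightarrow> y \<in> U"
        by (intro exI[of _ e]) simp
    qed
  next
    assume "open U"
    show "openin (seminorm_topology {cmod}) U"
      unfolding openin_seminorm_topology
    proof
      fix x assume "x \<in> U"
      with \<open>open U\<close> obtain e where "e > 0" "\<forall>y. dist y x < e \<longrightarrow> y \<in> U"
        by (meson open_dist)
      then show "\<exists>F e. finite F \<and> F \<subseteq> {cmod} \<and> 0 < e \<and> {y. \<forall>p\<in>F. p (y - x) < e} \<subseteq> U"
        by (intro exI[of _ "{cmod}"] exI[of _ e]) (auto simp: dist_norm)
    qed
  qed
  then show ?thesis
    by (simp add: topology_eq)
qed

definition upper_semicontinuous_on_top :: "'a topology \<Rightarrow> ('a \<Rightarrow> real) \<Rightarrow> bool" where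
  "upper_semicontinuous_on_top \<Omega> v \<longleftrightarrow> (\<forall>a. openin \<Omega> {x \<in> topspace \<Omega>. v x < a})"

definition nachbin_family :: "'a topology \<Rightarrow> ('a \<Rightarrow> real) set \<Rightarrow> bool" where
  "nachbin_family \<Omega> V \<longleftrightarrow>
     (\<forall>v\<in>V. upper_semicontinuous_on_top \<Omega> v \<and> (\<forall>x\<in>topspace \<Omega>. 0 \<le> v x))"

definition nachbin_le :: "'a topology \<Rightarrow> ('a \<Rightarrow> real) set \<Rightarrow> ('a \<Rightarrow> real) set \<Rightarrow> bool" where
  "nachbin_le \<Omega> V V' \<longleftrightarrow> (\<forall>v\<in>V. \<exists>v'\<in>V'. \<forall>x\<in>topspace \<Omega>. v x \<le> v' x)"

definition supp :: "'a topology \<Rightarrow> ('a \<Rightarrow> 'x::zero) \<Rightarrow> 'a set" where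
  "supp \<Omega> f = \<Omega> closure_of {x \<in> topspace \<Omega>. f x \<noteq> 0}"

definition C_all :: "'a topology \<Rightarrow> ('x::ab_group_add \<Rightarrow> real) set \<Rightarrow> ('a \<Rightarrow> 'x) set" where
  "C_all \<Omega> \<A> = {f. continuous_map \<Omega> (seminorm_topology \<A>) f}"

definition C_b :: "'a topology \<Rightarrow> ('x::ab_group_add \<Rightarrow> real) set \<Rightarrow> ('a \<Rightarrow> 'x) set" where
  "C_b \<Omega> \<A> = {f \<in> C_all \<Omega> \<A>. \<forall>p\<in>\<A>. bounded ((\<lambda>x. p (f x)) ` topspace \<Omega>)}"

definition C_c :: "'a topology \<Rightarrow> ('x::ab_group_add \<Rightarrow> real) set \<Rightarrow> ('a \<Rightarrow> 'x) set" where
  "C_c \<Omega> \<A> = {f \<in> C_all \<Omega> \<A>. compactin \<Omega> (supp \<Omega> f)}"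

definition C_0 :: "'a topology \<Rightarrow> ('x::ab_group_add \<Rightarrow> real) set \<Rightarrow> ('a \<Rightarrow> 'x) set" where
  "C_0 \<Omega> \<A> = {f \<in> C_all \<Omega> \<A>. \<forall>p\<in>\<A>. \<forall>\<epsilon>>0. compactin \<Omega> {x \<in> topspace \<Omega>. p (f x) \<ge> \<epsilon>}}"

definition C_nonneg :: "'a topology \<Rightarrow> ('a \<Rightarrow> real) set" where
  "C_nonneg \<Omega> = {v. continuous_map \<Omega> euclideanreal v \<and> (\<forall>x\<in>topspace \<Omega>. 0 \<le> v x)}"

definition C_0_nonneg :: "'a topology \<Rightarrow> ('a \<Rightarrow> real) set" where
  "C_0_nonneg \<Omega> = {v \<in> C_nonneg \<Omega>. \<forall>\<epsilon>>0. compactin \<Omega> {x \<in> topspace \<Omega>. v x \<ge> \<epsilon>}}"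

definition CV_0 ::
    "'a topology \<Rightarrow> ('x::ab_group_add \<Rightarrow> real) set \<Rightarrow> ('a \<Rightarrow> real) set \<Rightarrow> ('a \<Rightarrow> 'x) set" where
  "CV_0 \<Omega> \<A> V = {f \<in> C_all \<Omega> \<A>. \<forall>v\<in>V. \<forall>p\<in>\<A>. \<forall>\<epsilon>>0.
     compactin \<Omega> {x \<in> topspace \<Omega>. v x * p (f x) \<ge> \<epsilon>}}"

text \<open>
  Valued in \<open>ennreal\<close>, so that the supremum always exists: it is \<open>\<infinity>\<close> for unbounded
  \<open>v \<cdot> (p \<circ> f)\<close> and \<open>0\<close> for empty \<open>\<Omega>\<close>.
\<close>

definition weighted_seminorm ::
    "'a topology \<Rightarrow> ('a \<Rightarrow> real) \<Rightarrow> ('x \<Rightarrow> real) \<Rightarrow> ('a \<Rightarrow> 'x) \<Rightarrow> ennreal" where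
  "weighted_seminorm \<Omega> v p f = (SUP x\<in>topspace \<Omega>. ennreal (v x * p (f x)))"

text \<open>
  \<open>module.span\<close> is the linear span for the given scalar multiplication, here the pointwise one on
  functions \<open>'a \<Rightarrow> 'x\<close>.
\<close>

definition tensor ::
    "(complex \<Rightarrow> 'x \<Rightarrow> 'x) \<Rightarrow> ('a \<Rightarrow> complex) set \<Rightarrow> ('a \<Rightarrow> 'x::ab_group_add) set" where
  "tensor smul \<Phi> =
     module.span (\<lambda>c u t. smul c (u t)) {(\<lambda>t. smul (\<phi> t) x) | \<phi> x. \<phi> \<in> \<Phi>}"

definition convex_combinations ::
    "(complex \<Rightarrow> 'x \<Rightarrow> 'x) \<Rightarrow> 'x::ab_group_add set \<Rightarrow> 'x set" where
  "convex_combinations smul X\<^sub>0 =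
     {(\<Sum>x\<in>F. smul (complex_of_real (c x)) x) | F c.
        finite F \<and> F \<subseteq> X\<^sub>0 \<and> (\<forall>x\<in>F. 0 \<le> c x) \<and> sum c F = 1}"

definition closed_convex_hull ::
    "(complex \<Rightarrow> 'x \<Rightarrow> 'x) \<Rightarrow> ('x::ab_group_add \<Rightarrow> real) set \<Rightarrow> 'x set \<Rightarrow> 'x set" where
  "closed_convex_hull smul \<A> X\<^sub>0 = seminorm_topology \<A> closure_of convex_combinations smul X\<^sub>0"

end

theory Submission
  imports Defs
begin

text \<open>
  As \<open>\<Omega>\<close> is arbitrary, all auxiliary functions are pulled back along \<open>f\<close>. A finite sum \<open>q \<ge> p\<close> of
  seminorms separates the finite set \<open>Z = f T\<^sub>0 \<union> {y\<^sub>0}\<close>, since \<open>X\<close> is Hausdorff. The bumps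
  \<open>max 0 (r y - q (f s - y))\<close> for finitely many values \<open>y\<close> of \<open>f\<close> are normalised to a partition of
  unity \<open>\<psi>\<close>, the missing mass outside a compact set \<open>L\<close> being given to \<open>y\<^sub>0\<close>, and
  \<open>u s = \<Sum>y. \<psi> y s y\<close>. Radii below half the \<open>q\<close>-distance to \<open>Z\<close> make \<open>u\<close> interpolate \<open>f\<close> on \<open>T\<^sub>0\<close>.

  For (a), \<open>y\<^sub>0 = 0\<close> and \<open>L = {q \<circ> f \<ge> d} \<union> T\<^sub>0\<close>: a value \<open>y \<noteq> 0\<close> then only has weight where
  \<open>q \<circ> f \<ge> d / 2\<close>, which is compact because \<open>f\<close> vanishes at infinity. For (b), \<open>L = {v \<ge> d} \<union> T\<^sub>0\<close>
  and \<open>y\<^sub>0\<close> is \<open>0\<close> if \<open>f\<close> has a zero, so that \<open>u\<close> vanishes there too, and any value of \<open>f\<close>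
  otherwise, when the support condition is void.
\<close>

section \<open>Supports, superlevel sets and the weighted seminorm\<close>

lemma is_seminormD:
  assumes "is_seminorm smul p"
  shows "0 \<le> p x" "p (x + y) \<le> p x + p y" "p (smul c x) = cmod c * p x"
  using assms by (auto simp: is_seminorm_def)

lemma supp_subset:
  assumes "closedin \<Omega> K" and "\<And>t. t \<in> topspace \<Omega> \<Longrightarrow> f t \<noteq> 0 \<Longrightarrow> t \<in> K"
  shows "supp \<Omega> f \<subseteq> K"
  unfolding supp_def using assms by (intro closure_of_minimal) auto

lemma closedin_supp: "closedin \<Omega> (supp \<Omega> f)"
  unfolding supp_def by simp

lemma in_supp: "t \<in> topspace \<Omega> \<Longrightarrow> f t \<noteq> 0 \<Longrightarrow> t \<in> supp \<Omega> f"
  unfolding supp_def using closure_of_subset[of "{x \<in> topspace \<Omega>. f x \<noteq> 0}" \<Omega>] by auto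

text \<open>Closedness of \<open>K\<close> is asked for separately because compact sets need not be
  closed when \<open>\<Omega>\<close> is not Hausdorff; the support is then a closed subset of a
  compact set.\<close>

lemma compactin_supp:
  assumes "compactin \<Omega> K" "closedin \<Omega> K" and "\<And>t. t \<in> topspace \<Omega> \<Longrightarrow> f t \<noteq> 0 \<Longrightarrow> t \<in> K"
  shows "compactin \<Omega> (supp \<Omega> f)"
  using closed_compactin[OF assms(1) supp_subset[OF assms(2,3)] closedin_supp] .

text \<open>Shown through the open complement: near \<open>x\<close> the weight stays below some
  \<open>a\<close> with \<open>a * g x < e\<close>, and \<open>g\<close> stays below
  \<open>e / a\<close>. This makes weighted superlevel sets closed subsets of a compact
  support.\<close>

lemma closedin_usc_mult_superlevel:
  assumes v: "upper_semicontinuous_on_top \<Omega> v" "\<forall>x\<in>topspace \<Omega>. 0 \<le> v x"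
    and g: "continuous_map \<Omega> euclideanreal g" "\<forall>x\<in>topspace \<Omega>. 0 \<le> g x"
    and e: "0 < e"
  shows "closedin \<Omega> {x \<in> topspace \<Omega>. e \<le> v x * g x}"
proof -
  have "openin \<Omega> {x \<in> topspace \<Omega>. v x * g x < e}"
  proof (subst openin_subopen, intro ballI)
    fix x assume "x \<in> {x \<in> topspace \<Omega>. v x * g x < e}"
    then have x: "x \<in> topspace \<Omega>" "v x * g x < e" by auto
    \<comment> \<open>If \<open>g x = 0\<close>, any bound above \<open>v x\<close> serves;
      otherwise \<open>a\<close> lies strictly between \<open>v x\<close> and
      \<open>e / g x\<close>.\<close>
    obtain a where a: "v x < a" "a * g x < e"
    proof (cases "g x = 0")
      case True
      then show ?thesis using e that[of "v x + 1"] by simp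
    next
      case False
      then have "0 < g x" using g x by force
      then have "v x < e / g x" using x by (simp add: field_simps)
      then obtain a where "v x < a" "a < e / g x" using dense by blast
      then show ?thesis using that \<open>0 < g x\<close> by (simp add: field_simps)
    qed
    have a0: "0 < a" using a v x by force
    let ?U = "{y \<in> topspace \<Omega>. v y < a} \<inter> {y \<in> topspace \<Omega>. g y \<in> {..<e / a}}"
    have "openin \<Omega> ?U"
      using v g by (intro openin_Int openin_continuous_map_preimage[where Y = euclideanreal])
        (auto simp: upper_semicontinuous_on_top_def)
    moreover have "x \<in> ?U"
      using a a0 x by (simp add: field_simps)
    moreover have "v y * g y < e" if "y \<in> ?U" for y
    proof -
      have "v y * g y \<le> a * g y"
        using that g by (intro mult_right_mono) auto
      also have "\<dots> < e"
        using that a0 by (simp add: field_simps)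
      finally show ?thesis .
    qed
    ultimately show "\<exists>T. openin \<Omega> T \<and> x \<in> T \<and> T \<subseteq> {x \<in> topspace \<Omega>. v x * g x < e}"
      by (intro exI[of _ ?U]) blast
  qed
  then have "closedin \<Omega> (topspace \<Omega> - {x \<in> topspace \<Omega>. v x * g x < e})"
    by blast
  also have "topspace \<Omega> - {x \<in> topspace \<Omega>. v x * g x < e} = {x \<in> topspace \<Omega>. e \<le> v x * g x}"
    by auto
  finally show ?thesis .
qed

text \<open>Used for continuous weights: a compact superlevel set yields a positive bound by which
  \<open>\<epsilon>\<close> can be divided.\<close>

lemma compactin_bounded_above:
  assumes "compactin \<Omega> K" "continuous_map \<Omega> euclideanreal v"
  obtains M where "0 < M" "\<And>s. s \<in> K \<Longrightarrow> v s \<le> M"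
proof -
  have "compactin euclideanreal (v ` K)"
    using assms by (rule image_compactin)
  then have "bounded (v ` K)"
    by (simp add: compact_imp_bounded)
  then obtain M where M: "0 < M" "\<And>x. x \<in> v ` K \<Longrightarrow> norm x \<le> M"
    unfolding bounded_pos by blast
  then have "v s \<le> M" if "s \<in> K" for s
    using M(2)[of "v s"] that by (simp add: abs_le_iff)
  with M(1) show thesis
    by (rule that)
qed

lemma continuous_map_of_real:
  "continuous_map \<Omega> euclideanreal g \<Longrightarrow> continuous_map \<Omega> euclidean (\<lambda>s. complex_of_real (g s))"
  using continuous_map_compose[of \<Omega> euclideanreal g euclidean complex_of_real]
  by (simp add: o_def continuous_on_of_real continuous_on_id)

text \<open>Pointwise bounds below \<open>e\<close> would give only \<open>\<le> e\<close> for the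
  supremum; the margin \<open>e / 2\<close> makes the inequality strict.\<close>

lemma weighted_seminorm_less:
  assumes "0 < e" "\<And>s. s \<in> topspace \<Omega> \<Longrightarrow> v s * p (g s) \<le> e / 2"
  shows "weighted_seminorm \<Omega> v p g < ennreal e"
proof -
  have "weighted_seminorm \<Omega> v p g \<le> ennreal (e / 2)"
    unfolding weighted_seminorm_def using assms by (intro SUP_least ennreal_leI) auto
  also have "\<dots> < ennreal e"
    using assms(1) by (simp add: ennreal_less_iff)
  finally show ?thesis .
qed

section \<open>Calculus of seminorms on a complex vector space\<close>

context
  fixes smul :: "complex \<Rightarrow> 'x::ab_group_add \<Rightarrow> 'x"
  assumes vs: "vector_space smul"
begin

interpretation V: vector_space smul
  by (rule vs)

lemma seminorm_zero: "is_seminorm smul p \<Longrightarrow> p 0 = 0"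
  using is_seminormD(3)[of smul p 0 0] by simp

lemma seminorm_uminus: "is_seminorm smul p \<Longrightarrow> p (- x) = p x"
  using is_seminormD(3)[of smul p "-1" x] by simp

lemma seminorm_minus_commute: "is_seminorm smul p \<Longrightarrow> p (x - y) = p (y - x)"
  using seminorm_uminus[of p "x - y"] by simp

lemma seminorm_triangle: "is_seminorm smul p \<Longrightarrow> p (x - z) \<le> p (x - y) + p (y - z)"
  using is_seminormD(2)[of smul p "x - y" "y - z"] by simp

lemma seminorm_sum_le:
  assumes "is_seminorm smul p"
  shows "p (sum g A) \<le> (\<Sum>a\<in>A. p (g a))"
proof (induction A rule: infinite_finite_induct)
  case (insert a A)
  then show ?case
    using is_seminormD(2)[OF assms, of "g a" "sum g A"] by simp
qed (auto simp: seminorm_zero[OF assms])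

lemma is_seminorm_sum:
  assumes "\<And>p. p \<in> F \<Longrightarrow> is_seminorm smul p"
  shows "is_seminorm smul (\<lambda>x. \<Sum>p\<in>F. p x)"
  unfolding is_seminorm_def
  by (auto intro!: sum_nonneg sum_mono
      simp: is_seminormD[OF assms] sum_distrib_left simp flip: sum.distrib)

text \<open>If every \<open>p (x - y)\<close> were \<open>0\<close>, each basic neighbourhood of
  \<open>x\<close> would contain \<open>y\<close>, against the Hausdorff property.\<close>

lemma seminorm_separates:
  assumes "Hausdorff_space (seminorm_topology \<A>)" and "x \<noteq> y"
    and sn: "\<forall>p\<in>\<A>. is_seminorm smul p"
  obtains p where "p \<in> \<A>" and "0 < p (x - y)"
proof -
  have False if *: "\<And>p. p \<in> \<A> \<Longrightarrow> p (x - y) = 0"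
  proof -
    obtain U W where U: "openin (seminorm_topology \<A>) U" "x \<in> U" and W: "y \<in> W" "disjnt U W"
      using assms(1,2) unfolding Hausdorff_space_def by (metis UNIV_I topspace_seminorm_topology)
    from bspec[OF U(1)[unfolded openin_seminorm_topology] U(2)]
    obtain F e where F: "finite F" "F \<subseteq> \<A>" "0 < e" "{w. \<forall>p\<in>F. p (w - x) < e} \<subseteq> U"
      by iprover
    have "p (y - x) < e" if "p \<in> F" for p
      using that F(2,3) *[of p] sn seminorm_minus_commute[of p y x] by auto
    then have "y \<in> {w. \<forall>p\<in>F. p (w - x) < e}"
      by blast
    then show False
      using F(4) W by (auto simp: disjnt_def)
  qed
  then show thesis
    using that sn is_seminormD(1) by (metis order_less_le)
qed

section \<open>Continuity of maps into the seminorm topology\<close>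

text \<open>Reduces continuity to real-valued functions. Forwards, the reverse triangle inequality
  makes \<open>x \<mapsto> p (x - y)\<close> continuous; backwards, a basic neighbourhood of
  \<open>f s0\<close> pulls back to a finite intersection of open sets.\<close>

lemma continuous_map_seminorm_topology:
  assumes sn: "\<forall>p\<in>\<A>. is_seminorm smul p"
  shows "continuous_map \<Omega> (seminorm_topology \<A>) f \<longleftrightarrow>
    (\<forall>p\<in>\<A>. \<forall>y. continuous_map \<Omega> euclideanreal (\<lambda>s. p (f s - y)))" (is "?L \<longleftrightarrow> ?R")
proof
  assume L: ?L
  have "continuous_map (seminorm_topology \<A>) euclideanreal (\<lambda>x. p (x - y))" if p: "p \<in> \<A>" for p y
    unfolding continuous_map_def
  proof (intro conjI allI impI)
    fix U :: "real set" assume "openin euclidean U"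
    then have U: "open U" by simp
    have *: "\<exists>F e. finite F \<and> F \<subseteq> \<A> \<and> 0 < e \<and> {w. \<forall>p\<in>F. p (w - x) < e} \<subseteq> {x. p (x - y) \<in> U}"
      if x: "p (x - y) \<in> U" for x
    proof -
      obtain e where e: "e > 0" "\<And>a. \<bar>a - p (x - y)\<bar> < e \<Longrightarrow> a \<in> U"
        using U[unfolded open_dist dist_real_def, rule_format, OF x] by blast
      have snp: "is_seminorm smul p"
        using sn p by blast
      have "\<bar>p (w - y) - p (x - y)\<bar> \<le> p (w - x)" for w
        using seminorm_triangle[OF snp, of w y x] seminorm_triangle[OF snp, of x y w]
          seminorm_minus_commute[OF snp, of x w] by linarith
      then have "p (w - y) \<in> U" if "p (w - x) < e" for w
        using e(2)[of "p (w - y)"] that by (meson order_le_less_trans)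
      with e p show ?thesis
        by (intro exI[of _ "{p}"] exI[of _ e]) auto
    qed
    have "openin (seminorm_topology \<A>) {x. p (x - y) \<in> U}"
      unfolding openin_seminorm_topology by (intro ballI *) (erule CollectD)
    then show "openin (seminorm_topology \<A>) {x \<in> topspace (seminorm_topology \<A>). p (x - y) \<in> U}"
      by simp
  qed simp
  then show ?R
    using continuous_map_compose[OF L, unfolded o_def] by blast
next
  assume R: ?R
  show ?L
    unfolding continuous_map_def
  proof (intro conjI allI impI)
    fix U assume U: "openin (seminorm_topology \<A>) U"
    show "openin \<Omega> {s \<in> topspace \<Omega>. f s \<in> U}"
    proof (subst openin_subopen, intro ballI)
      fix s0 assume s0: "s0 \<in> {s \<in> topspace \<Omega>. f s \<in> U}"
      then have "f s0 \<in> U" by simp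
      from bspec[OF U[unfolded openin_seminorm_topology] this]
      obtain F e where F: "finite F" "F \<subseteq> \<A>" "0 < e" "{w. \<forall>p\<in>F. p (w - f s0) < e} \<subseteq> U"
        by iprover
      have "openin \<Omega> {s \<in> topspace \<Omega>. p (f s - f s0) \<in> {..<e}}" if "p \<in> F" for p
        using R that F by (intro openin_continuous_map_preimage[where Y = euclideanreal]) auto
      \<comment> \<open>\<open>topspace \<Omega>\<close> is intersected in because the intersection
        over an empty \<open>F\<close> is the whole type.\<close>
      then have "openin \<Omega> (topspace \<Omega> \<inter> (\<Inter>p\<in>F. {s \<in> topspace \<Omega>. p (f s - f s0) \<in> {..<e}}))"
        using F(1) by (cases "F = {}") (auto intro!: openin_Int openin_INT2)
      moreover have "s0 \<in> topspace \<Omega> \<inter> (\<Inter>p\<in>F. {s \<in> topspace \<Omega>. p (f s - f s0) \<in> {..<e}})"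
        using s0 F sn by (auto simp: subset_iff seminorm_zero)
      moreover have "topspace \<Omega> \<inter> (\<Inter>p\<in>F. {s \<in> topspace \<Omega>. p (f s - f s0) \<in> {..<e}})
          \<subseteq> {s \<in> topspace \<Omega>. f s \<in> U}"
        using F(4) by auto
      ultimately show "\<exists>T. openin \<Omega> T \<and> s0 \<in> T \<and> T \<subseteq> {s \<in> topspace \<Omega>. f s \<in> U}"
        by blast
    qed
  qed simp
qed

text \<open>A continuous \<open>k\<close> vanishing at \<open>t\<close> and dominating
  \<open>p (f s - f t)\<close> controls every \<open>p (f s - y)\<close> near \<open>t\<close> by
  the reverse triangle inequality, so sums and multiples only need such a \<open>k\<close>.\<close>

lemma continuous_map_seminorm_topologyI:
  assumes sn: "\<forall>p\<in>\<A>. is_seminorm smul p"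
    and loc: "\<And>p t. p \<in> \<A> \<Longrightarrow> t \<in> topspace \<Omega> \<Longrightarrow>
      \<exists>k. continuous_map \<Omega> euclideanreal k \<and> k t = 0 \<and> (\<forall>s. p (f s - f t) \<le> k s)"
  shows "continuous_map \<Omega> (seminorm_topology \<A>) f"
  unfolding continuous_map_seminorm_topology[OF sn]
proof (intro ballI allI)
  fix p y assume p: "p \<in> \<A>"
  then have snp: "is_seminorm smul p"
    using sn by blast
  \<comment> \<open>The \<epsilon> criterion is stated for a metric topology; for the reals it
    coincides with the Euclidean one.\<close>
  have "continuous_map \<Omega> Met_TC.mtopology (\<lambda>s. p (f s - y))"
    unfolding Met_TC.continuous_map_to_metric
  proof (intro ballI allI impI)
    fix t \<epsilon> assume t: "t \<in> topspace \<Omega>" and e: "0 < (\<epsilon>::real)"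
    obtain k where k: "continuous_map \<Omega> euclideanreal k" "k t = 0" "\<And>s. p (f s - f t) \<le> k s"
      using loc[OF p t] by blast
    have "openin \<Omega> {s \<in> topspace \<Omega>. k s \<in> {..<\<epsilon>}}"
      using k by (intro openin_continuous_map_preimage[where Y = euclideanreal]) auto
    moreover have "\<bar>p (f t - y) - p (f s - y)\<bar> \<le> k s" for s
      using seminorm_triangle[OF snp, of "f s" y "f t"] seminorm_triangle[OF snp, of "f t" y "f s"]
        seminorm_minus_commute[OF snp, of "f s" "f t"] k(3)[of s] by linarith
    ultimately show "\<exists>U. openin \<Omega> U \<and> t \<in> U \<and>
        (\<forall>s\<in>U. p (f s - y) \<in> Met_TC.mball (p (f t - y)) \<epsilon>)"
      using t e k(2) by (intro exI[of _ "{s \<in> topspace \<Omega>. k s \<in> {..<\<epsilon>}}"])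
        (auto simp: dist_real_def intro: order_le_less_trans)
  qed
  then show "continuous_map \<Omega> euclideanreal (\<lambda>s. p (f s - y))"
    by simp
qed

lemma C_all_add:
  assumes sn: "\<forall>p\<in>\<A>. is_seminorm smul p" and "f \<in> C_all \<Omega> \<A>" "g \<in> C_all \<Omega> \<A>"
  shows "(\<lambda>t. f t + g t) \<in> C_all \<Omega> \<A>"
  unfolding C_all_def mem_Collect_eq
proof (rule continuous_map_seminorm_topologyI[OF sn])
  fix p t assume p: "p \<in> \<A>"
  have "p (f s + g s - (f t + g t)) \<le> p (f s - f t) + p (g s - g t)" for s
    using is_seminormD(2)[of smul p "f s - f t" "g s - g t"] sn p by (simp add: algebra_simps)
  then show "\<exists>k. continuous_map \<Omega> euclideanreal k \<and> k t = 0 \<and> (\<forall>s. p (f s + g s - (f t + g t)) \<le> k s)"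
    using assms p unfolding C_all_def
    by (intro exI[of _ "\<lambda>s. p (f s - f t) + p (g s - g t)"])
      (auto simp: continuous_map_seminorm_topology[OF sn] seminorm_zero
        intro!: continuous_map_add continuous_map_real_mult continuous_map_const)
qed

lemma C_all_scale_const:
  assumes sn: "\<forall>p\<in>\<A>. is_seminorm smul p" and "f \<in> C_all \<Omega> \<A>"
  shows "(\<lambda>t. smul c (f t)) \<in> C_all \<Omega> \<A>"
  unfolding C_all_def mem_Collect_eq
proof (rule continuous_map_seminorm_topologyI[OF sn])
  fix p t assume p: "p \<in> \<A>"
  have "p (smul c (f s) - smul c (f t)) = cmod c * p (f s - f t)" for s
    using is_seminormD(3)[of smul p c "f s - f t"] sn p by (simp add: V.scale_right_diff_distrib)
  then show "\<exists>k. continuous_map \<Omega> euclideanreal k \<and> k t = 0 \<and>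
      (\<forall>s. p (smul c (f s) - smul c (f t)) \<le> k s)"
    using assms p unfolding C_all_def
    by (intro exI[of _ "\<lambda>s. cmod c * p (f s - f t)"])
      (auto simp: continuous_map_seminorm_topology[OF sn] seminorm_zero
        intro!: continuous_map_add continuous_map_real_mult continuous_map_const)
qed

lemma C_all_scale_vector:
  assumes sn: "\<forall>p\<in>\<A>. is_seminorm smul p" and "\<phi> \<in> C_all \<Omega> {cmod}"
  shows "(\<lambda>t. smul (\<phi> t) x) \<in> C_all \<Omega> \<A>"
  unfolding C_all_def mem_Collect_eq
proof (rule continuous_map_seminorm_topologyI[OF sn])
  fix p t assume p: "p \<in> \<A>"
  have "p (smul (\<phi> s) x - smul (\<phi> t) x) = cmod (\<phi> s - \<phi> t) * p x" for s
    using is_seminormD(3)[of smul p "\<phi> s - \<phi> t" x] sn p by (simp add: V.scale_left_diff_distrib)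
  then show "\<exists>k. continuous_map \<Omega> euclideanreal k \<and> k t = 0 \<and>
      (\<forall>s. p (smul (\<phi> s) x - smul (\<phi> t) x) \<le> k s)"
    using assms(2) unfolding C_all_def seminorm_topology_cmod
    by (intro exI[of _ "\<lambda>s. cmod (\<phi> s - \<phi> t) * p x"])
      (auto intro!: continuous_map_real_mult continuous_map_norm continuous_map_diff)
qed

section \<open>Tensor products inside the weighted spaces\<close>

lemma vector_space_fun: "vector_space (\<lambda>c (u :: 'a \<Rightarrow> 'x) t. smul c (u t))"
  by unfold_locales (auto simp: fun_eq_iff V.scale_right_distrib V.scale_left_distrib)

text \<open>\<open>C_c\<close> is a linear subspace containing the generators. For a sum, the union
  of the two supports is a closed compact set outside which the sum vanishes.\<close>

lemma tensor_C_c_subset_C_c: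
  assumes sn: "\<forall>p\<in>\<A>. is_seminorm smul p"
  shows "tensor smul (C_c \<Omega> {cmod}) \<subseteq> C_c \<Omega> \<A>"
proof -
  interpret W: vector_space "\<lambda>c (u :: 'a \<Rightarrow> 'x) t. smul c (u t)"
    by (rule vector_space_fun)
  show ?thesis
    unfolding tensor_def
  proof (rule W.span_minimal)
    show "{\<lambda>t. smul (\<phi> t) x |\<phi> x. \<phi> \<in> C_c \<Omega> {cmod}} \<subseteq> C_c \<Omega> \<A>"
    proof clarify
      fix \<phi> x assume "\<phi> \<in> C_c \<Omega> {cmod}"
      then show "(\<lambda>t. smul (\<phi> t) x) \<in> C_c \<Omega> \<A>"
        using C_all_scale_vector[OF sn]
        by (auto simp: C_c_def intro!: compactin_supp[of _ "supp \<Omega> \<phi>"] closedin_supp in_supp)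
    qed
    show "W.subspace (C_c \<Omega> \<A>)"
    proof (rule W.subspaceI)
      have "supp \<Omega> (0 :: 'a \<Rightarrow> 'x) = {}"
        by (simp add: supp_def)
      then show "0 \<in> C_c \<Omega> \<A>"
        by (simp add: C_c_def C_all_def zero_fun_def)
    next
      fix f g assume fg: "f \<in> C_c \<Omega> \<A>" "g \<in> C_c \<Omega> \<A>"
      have "compactin \<Omega> (supp \<Omega> (f + g))"
      proof (rule compactin_supp)
        show "compactin \<Omega> (supp \<Omega> f \<union> supp \<Omega> g)"
          using fg by (intro compactin_Un) (simp_all add: C_c_def)
        show "t \<in> supp \<Omega> f \<union> supp \<Omega> g" if "t \<in> topspace \<Omega>" "(f + g) t \<noteq> 0" for t
        proof (cases "f t = 0")
          case True
          then have "g t \<noteq> 0" using that by simp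
          then show ?thesis using in_supp[of t \<Omega> g] that by blast
        qed (use in_supp[of t \<Omega> f] that in blast)
      qed (intro closedin_Un closedin_supp)
      then show "f + g \<in> C_c \<Omega> \<A>"
        using fg C_all_add[OF sn, of f \<Omega> g] by (simp add: C_c_def plus_fun_def)
    next
      fix c f assume f: "f \<in> C_c \<Omega> \<A>"
      then show "(\<lambda>t. smul c (f t)) \<in> C_c \<Omega> \<A>"
        using C_all_scale_const[OF sn]
        by (auto simp: C_c_def intro!: compactin_supp[of _ "supp \<Omega> f"] closedin_supp in_supp)
    qed
  qed
qed

lemma continuous_map_seminorm_comp:
  assumes sn: "\<forall>p\<in>\<A>. is_seminorm smul p" and "f \<in> C_all \<Omega> \<A>" "p \<in> \<A>"
  shows "continuous_map \<Omega> euclideanreal (\<lambda>s. p (f s))"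
proof -
  have "continuous_map \<Omega> euclideanreal (\<lambda>s. p (f s - 0))"
    using assms unfolding C_all_def mem_Collect_eq continuous_map_seminorm_topology[OF sn] by blast
  then show ?thesis by simp
qed

text \<open>Since \<open>p (f x) > 0\<close> forces \<open>f x \<noteq> 0\<close>, each superlevel
  set lies in the compact support, and it is closed by semicontinuity of \<open>v\<close>.\<close>

lemma C_c_subset_CV_0:
  assumes sn: "\<forall>p\<in>\<A>. is_seminorm smul p" and V: "nachbin_family \<Omega> V"
  shows "C_c \<Omega> \<A> \<subseteq> CV_0 \<Omega> \<A> V"
proof
  fix f assume f: "f \<in> C_c \<Omega> \<A>"
  then have fC: "f \<in> C_all \<Omega> \<A>" and K: "compactin \<Omega> (supp \<Omega> f)"
    by (auto simp: C_c_def)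
  have "compactin \<Omega> {x \<in> topspace \<Omega>. e \<le> v x * p (f x)}" if "v \<in> V" "p \<in> \<A>" "0 < e" for v p e
  proof (rule closed_compactin[OF K])
    have snp: "is_seminorm smul p" using sn that by blast
    show "closedin \<Omega> {x \<in> topspace \<Omega>. e \<le> v x * p (f x)}"
      using V that is_seminormD(1)[OF snp]
      by (intro closedin_usc_mult_superlevel continuous_map_seminorm_comp[OF sn fC])
        (auto simp: nachbin_family_def)
    show "{x \<in> topspace \<Omega>. e \<le> v x * p (f x)} \<subseteq> supp \<Omega> f"
      using that seminorm_zero[OF snp] by (auto intro!: in_supp)
  qed
  then show "f \<in> CV_0 \<Omega> \<A> V"
    using fC by (simp add: CV_0_def)
qed

lemma tensor_sum:
  assumes "\<And>y. y \<in> Y \<Longrightarrow> (\<lambda>s. complex_of_real (\<psi> y s)) \<in> \<Phi>"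
  shows "(\<lambda>s. \<Sum>y\<in>Y. smul (complex_of_real (\<psi> y s)) y) \<in> tensor smul \<Phi>"
proof -
  interpret W: vector_space "\<lambda>c (u :: 'a \<Rightarrow> 'x) t. smul c (u t)"
    by (rule vector_space_fun)
  have "(\<Sum>y\<in>Y. (\<lambda>s. smul (complex_of_real (\<psi> y s)) y)) \<in> tensor smul \<Phi>"
    unfolding tensor_def using assms by (intro W.span_sum W.span_base CollectI exI conjI) (rule refl, simp)
  also have "(\<Sum>y\<in>Y. (\<lambda>s. smul (complex_of_real (\<psi> y s)) y)) =
      (\<lambda>s. \<Sum>y\<in>Y. smul (complex_of_real (\<psi> y s)) y)"
    by (induction Y rule: infinite_finite_induct) (auto simp: fun_eq_iff)
  finally show ?thesis .
qed

section \<open>Convex combinations with prescribed coefficients\<close>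

lemma convex_combination_in_hull:
  assumes "finite Y" "Y \<subseteq> X\<^sub>0" "\<And>y. y \<in> Y \<Longrightarrow> 0 \<le> c y" "sum c Y = 1"
  shows "(\<Sum>y\<in>Y. smul (complex_of_real (c y)) y) \<in> closed_convex_hull smul \<A> X\<^sub>0"
proof -
  have "(\<Sum>y\<in>Y. smul (complex_of_real (c y)) y) \<in> convex_combinations smul X\<^sub>0"
    using assms unfolding convex_combinations_def by blast
  then show ?thesis
    unfolding closed_convex_hull_def
    using closure_of_subset[of "convex_combinations smul X\<^sub>0" "seminorm_topology \<A>"] by auto
qed

text \<open>The mechanism of interpolation: where only the vector \<open>x\<close> carries weight,
  the combination collapses to \<open>x\<close>.\<close>

lemma convex_combination_eq:
  assumes "finite Y" "sum c Y = 1" "\<And>y. y \<in> Y \<Longrightarrow> c y \<noteq> 0 \<Longrightarrow> y = x"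
  shows "(\<Sum>y\<in>Y. smul (complex_of_real (c y)) y) = x"
proof -
  have "(\<Sum>y\<in>Y. smul (complex_of_real (c y)) y) = (\<Sum>y\<in>Y. smul (complex_of_real (c y)) x)"
  proof (rule sum.cong)
    fix y assume "y \<in> Y"
    then show "smul (complex_of_real (c y)) y = smul (complex_of_real (c y)) x"
      using assms(3)[of y] by (cases "c y = 0") auto
  qed simp
  also have "\<dots> = x"
    using assms(2) by (simp flip: V.scale_sum_left of_real_sum)
  finally show ?thesis .
qed

text \<open>By homogeneity and subadditivity the error is at most the average of the errors
  \<open>a * p (x - y)\<close> with weights \<open>c y\<close>, so only vectors with positive weight
  need to be estimated.\<close>

lemma convex_combination_dist_le:
  assumes snp: "is_seminorm smul p" and "finite Y" "\<And>y. y \<in> Y \<Longrightarrow> 0 \<le> c y" "sum c Y = 1" "0 \<le> a"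
    and le: "\<And>y. y \<in> Y \<Longrightarrow> 0 < c y \<Longrightarrow> a * p (x - y) \<le> e"
  shows "a * p (x - (\<Sum>y\<in>Y. smul (complex_of_real (c y)) y)) \<le> e"
proof -
  \<comment> \<open>As the coefficients add up to \<open>1\<close>, \<open>x\<close> is the same
    combination of copies of itself.\<close>
  have "x = (\<Sum>y\<in>Y. smul (complex_of_real (c y)) x)"
    using assms(4) by (simp flip: V.scale_sum_left of_real_sum)
  then have "x - (\<Sum>y\<in>Y. smul (complex_of_real (c y)) y) =
      (\<Sum>y\<in>Y. smul (complex_of_real (c y)) x) - (\<Sum>y\<in>Y. smul (complex_of_real (c y)) y)"
    by (rule arg_cong)
  then have "p (x - (\<Sum>y\<in>Y. smul (complex_of_real (c y)) y)) =
      p (\<Sum>y\<in>Y. smul (complex_of_real (c y)) (x - y))"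
    by (simp add: V.scale_right_diff_distrib sum_subtractf)
  also have "\<dots> \<le> (\<Sum>y\<in>Y. p (smul (complex_of_real (c y)) (x - y)))"
    by (rule seminorm_sum_le[OF snp])
  also have "\<dots> = (\<Sum>y\<in>Y. c y * p (x - y))"
    using assms(3) by (intro sum.cong) (auto simp: is_seminormD(3)[OF snp])
  finally have "a * p (x - (\<Sum>y\<in>Y. smul (complex_of_real (c y)) y)) \<le> a * (\<Sum>y\<in>Y. c y * p (x - y))"
    using assms(5) by (rule mult_left_mono)
  also have "\<dots> = (\<Sum>y\<in>Y. c y * (a * p (x - y)))"
    by (simp add: sum_distrib_left mult_ac)
  also have "\<dots> \<le> (\<Sum>y\<in>Y. c y * e)"
  proof (rule sum_mono)
    fix y assume "y \<in> Y"
    then show "c y * (a * p (x - y)) \<le> c y * e"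
      using assms(3)[of y] le[of y] by (cases "c y = 0") (auto intro: mult_left_mono)
  qed
  also have "\<dots> = e"
    using assms(4) by (simp flip: sum_distrib_right)
  finally show ?thesis .
qed

section \<open>A partition of unity pulled back along \<open>f\<close>\<close>

text \<open>The last two conclusions serve interpolation: at a point with \<open>f s = z\<close> in
  \<open>Z\<close> an active \<open>y \<noteq> z\<close> would satisfy
  \<open>q (y - z) \<le> 0\<close>, contradicting positivity. The exception \<open>y = y0\<close>
  off \<open>L\<close> is the price of the total mass \<open>1\<close>.\<close>

lemma separating_partition:
  fixes f :: "'a \<Rightarrow> 'x"
  assumes snq: "is_seminorm smul q"
    and cont: "\<And>y. continuous_map \<Omega> euclideanreal (\<lambda>s. q (f s - y))"
    and L: "compactin \<Omega> L" and Z: "finite Z" "y0 \<in> Z"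
    and sep: "\<And>z z'. z \<in> Z \<Longrightarrow> z' \<in> Z \<Longrightarrow> z \<noteq> z' \<Longrightarrow> 0 < q (z - z')" and \<eta>: "0 < \<eta>"
  obtains Y \<psi> where "finite Y" "Y \<subseteq> f ` L \<union> Z"
    and "\<And>y. y \<in> Y \<Longrightarrow> continuous_map \<Omega> euclideanreal (\<psi> y)"
    and "\<And>y s. y \<in> Y \<Longrightarrow> 0 \<le> \<psi> y s" and "\<And>s. (\<Sum>y\<in>Y. \<psi> y s) = 1"
    and "\<And>y s. y \<in> Y \<Longrightarrow> s \<in> topspace \<Omega> \<Longrightarrow> 0 < \<psi> y s \<Longrightarrow>
      q (f s - y) < \<eta> \<or> (y = y0 \<and> s \<notin> L)"
    and "\<And>y z. y \<in> Y \<Longrightarrow> z \<in> Z \<Longrightarrow> y \<noteq> z \<Longrightarrow> 0 < q (y - z)"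
    and "\<And>y z s. y \<in> Y \<Longrightarrow> z \<in> Z \<Longrightarrow> y \<noteq> z \<Longrightarrow> s \<in> topspace \<Omega> \<Longrightarrow> 0 < \<psi> y s \<Longrightarrow> y \<noteq> y0 \<or> s \<in> L \<Longrightarrow>
      q (y - z) \<le> 2 * q (f s - z)"
proof -
  note q0 = is_seminormD(1)[OF snq]
  \<comment> \<open>Only positive distances enter the minimum, so \<open>r y\<close> is positive
    also when \<open>q\<close> does not distinguish \<open>y\<close> from some point of
    \<open>Z\<close>.\<close>
  define r where "r y = Min (insert \<eta> ((\<lambda>z. q (y - z) / 2) ` {z \<in> Z. 0 < q (y - z)}))" for y
  have r_pos: "0 < r y" and r_le: "r y \<le> \<eta>" for y
    using Z \<eta> unfolding r_def by auto
  have r_half: "r y \<le> q (y - z) / 2" if "z \<in> Z" "0 < q (y - z)" for y z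
    using Z that unfolding r_def by (intro Min_le) auto
  \<comment> \<open>Values that are \<open>q\<close>-indistinguishable from a point of \<open>Z\<close> are replaced by that point.\<close>
  define S where "S = {y \<in> f ` L \<union> Z. \<forall>z\<in>Z. y \<noteq> z \<longrightarrow> 0 < q (y - z)}"
  have ZS: "Z \<subseteq> S"
    using sep by (auto simp: S_def)
  have near_S: "\<exists>y\<in>S. q (f s - y) = 0" if "s \<in> L" for s
  proof (cases "\<exists>z\<in>Z. q (f s - z) = 0")
    case True
    then show ?thesis using ZS by blast
  next
    case False
    then have "f s \<in> S"
      using that q0 by (auto simp: S_def order_less_le)
    then show ?thesis using seminorm_zero[OF snq] by (intro bexI[of _ "f s"]) simp_all
  qed
  \<comment> \<open>Halving the radius gives \<open>b y s > r y / 2\<close> on \<open>W y\<close>,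
    hence a common positive lower bound of \<open>B\<close> on \<open>L\<close>.\<close>
  define W where "W y = {s \<in> topspace \<Omega>. q (f s - y) \<in> {..<r y / 2}}" for y
  have "openin \<Omega> (W y)" for y
    unfolding W_def by (rule openin_continuous_map_preimage[OF cont]) auto
  moreover have "L \<subseteq> \<Union>(W ` S)"
  proof
    fix s assume s: "s \<in> L"
    then obtain y where "y \<in> S" "q (f s - y) = 0"
      using near_S by blast
    moreover have "s \<in> topspace \<Omega>"
      using L s compactin_subset_topspace by blast
    ultimately have "y \<in> S" "s \<in> W y"
      using r_pos[of y] by (simp_all add: W_def)
    then show "s \<in> \<Union>(W ` S)"
      by blast
  qed
  ultimately obtain \<F> where "finite \<F>" "\<F> \<subseteq> W ` S" "L \<subseteq> \<Union>\<F>"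
    using compactinD[OF L, of "W ` S"] by blast
  then obtain Y0 where Y0: "finite Y0" "Y0 \<subseteq> S" "L \<subseteq> \<Union>(W ` Y0)"
    using finite_subset_image[of \<F> W S] by blast
  define Y where "Y = insert y0 Y0"
  have Y: "finite Y" "Y \<subseteq> S" "y0 \<in> Y"
    using Y0 ZS Z by (auto simp: Y_def)
  define b where "b y s = max 0 (r y - q (f s - y))" for y s
  define B where "B s = (\<Sum>y\<in>Y. b y s)" for s
  define \<beta> where "\<beta> = Min (r ` Y) / 2"
  \<comment> \<open>\<open>B \<ge> \<beta>\<close> on \<open>L\<close>, so the truncation keeps \<open>\<phi>\<close> continuous without changing it on \<open>L\<close>.\<close>
  define \<phi> where "\<phi> y s = b y s / max (B s) \<beta>" for y s
  define \<psi> where "\<psi> y s = \<phi> y s + (if y = y0 then 1 - (\<Sum>x\<in>Y. \<phi> x s) else 0)" for y s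
  have "Min (r ` Y) \<in> r ` Y"
    using Y by (intro Min_in) auto
  then have \<beta>: "0 < \<beta>"
    using r_pos by (auto simp: \<beta>_def)
  have \<beta>_le: "\<beta> \<le> r y / 2" if "y \<in> Y" for y
    using Y that unfolding \<beta>_def by (intro divide_right_mono Min_le) auto
  have b0: "0 \<le> b y s" for y s
    by (simp add: b_def)
  have den: "0 < max (B s) \<beta>" for s
    using \<beta> by simp
  have \<phi>0: "0 \<le> \<phi> y s" for y s
    unfolding \<phi>_def by (intro divide_nonneg_pos b0 den)
  have sum_\<phi>: "(\<Sum>y\<in>Y. \<phi> y s) = B s / max (B s) \<beta>" for s
    by (simp add: \<phi>_def B_def sum_divide_distrib)
  have sum_le: "(\<Sum>y\<in>Y. \<phi> y s) \<le> 1" for s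
    unfolding sum_\<phi> using den[of s] by (simp add: divide_le_eq)
  have sum_L: "(\<Sum>y\<in>Y. \<phi> y s) = 1" if s: "s \<in> L" for s
  proof -
    obtain y where y: "y \<in> Y" "s \<in> W y"
      using Y0(3) s by (auto simp: Y_def)
    then have "\<beta> \<le> b y s"
      using \<beta>_le[of y] by (auto simp: b_def W_def)
    also have "b y s \<le> B s"
      unfolding B_def using y Y b0 by (intro member_le_sum) auto
    finally show ?thesis
      unfolding sum_\<phi> using \<beta> by (simp add: max_def)
  qed
  have cont_b: "continuous_map \<Omega> euclideanreal (b y)" for y
    unfolding b_def by (intro continuous_map_real_max continuous_map_diff cont) simp_all
  have "continuous_map \<Omega> euclideanreal B"
    unfolding B_def by (intro continuous_map_sum cont_b Y)
  then have cont_\<phi>: "continuous_map \<Omega> euclideanreal (\<phi> y)" for y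
    unfolding \<phi>_def using den
    by (intro continuous_map_real_divide continuous_map_real_max cont_b)
      (auto simp: less_imp_neq[THEN not_sym])
  \<comment> \<open>The correction in \<open>\<psi>\<close> concerns \<open>y0\<close> only and
    vanishes on \<open>L\<close>; in all other cases positive weight comes from the bump.\<close>
  have \<psi>_pos: "q (f s - y) < r y" if "0 < \<psi> y s" "y \<noteq> y0 \<or> s \<in> L" for y s
  proof -
    have "\<psi> y s = \<phi> y s"
      using that(2) sum_L by (auto simp: \<psi>_def)
    then have "0 < b y s"
      using that(1) zero_less_divide_iff[of "b y s"] den[of s] b0[of y s] by (auto simp: \<phi>_def)
    then show ?thesis
      by (simp add: b_def)
  qed
  show thesis
  proof (rule that)
    show "finite Y" "Y \<subseteq> f ` L \<union> Z"
      using Y by (auto simp: S_def)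
    show "continuous_map \<Omega> euclideanreal (\<psi> y)" for y
    proof -
      have "continuous_map \<Omega> euclideanreal (\<lambda>s. \<phi> y s + (1 - (\<Sum>x\<in>Y. \<phi> x s)))"
        by (intro continuous_map_add continuous_map_diff continuous_map_sum cont_\<phi> Y) simp_all
      then show ?thesis
        using cont_\<phi>[of y] by (cases "y = y0") (simp_all add: \<psi>_def[abs_def])
    qed
    show "0 \<le> \<psi> y s" for y s
      using \<phi>0[of y s] sum_le[of s] by (simp add: \<psi>_def)
    show "(\<Sum>y\<in>Y. \<psi> y s) = 1" for s
      using Y by (simp add: \<psi>_def sum.distrib)
    show "q (f s - y) < \<eta> \<or> (y = y0 \<and> s \<notin> L)" if "0 < \<psi> y s" for y s
      using \<psi>_pos[OF that] r_le[of y] by fastforce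
    show pos: "0 < q (y - z)" if "y \<in> Y" "z \<in> Z" "y \<noteq> z" for y z
      using that Y by (auto simp: S_def)
    \<comment> \<open>\<open>q (y - z) \<le> r y + q (f s - z)\<close> with
      \<open>r y \<le> q (y - z) / 2\<close>; absorbing the half gives the factor
      \<open>2\<close>.\<close>
    show "q (y - z) \<le> 2 * q (f s - z)"
      if "y \<in> Y" "z \<in> Z" "y \<noteq> z" "0 < \<psi> y s" "y \<noteq> y0 \<or> s \<in> L" for y z s
      using \<psi>_pos[OF that(4,5)] r_half[OF that(2) pos[OF that(1-3)]]
        seminorm_triangle[OF snq, of y z "f s"] seminorm_minus_commute[OF snq, of y "f s"] by linarith
  qed
qed

section \<open>Finite sums of seminorms\<close>

text \<open>One seminorm for each ordered pair of distinct points of \<open>Z\<close> suffices;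
  \<open>p\<close> joins \<open>F\<close> so that the sum dominates \<open>p\<close>.\<close>

lemma finite_separating_seminorms:
  assumes sn: "\<forall>p\<in>\<A>. is_seminorm smul p" and H: "Hausdorff_space (seminorm_topology \<A>)"
    and Z: "finite Z" and p: "p \<in> \<A>"
  obtains F where "finite F" "F \<subseteq> \<A>" "p \<in> F"
    and "\<And>z z'. z \<in> Z \<Longrightarrow> z' \<in> Z \<Longrightarrow> z \<noteq> z' \<Longrightarrow> 0 < (\<Sum>p\<in>F. p (z - z'))"
proof -
  have "\<exists>p\<in>\<A>. 0 < p (z - z')" if "z \<noteq> z'" for z z'
    using seminorm_separates[OF H that sn] by blast
  then obtain g where g: "\<And>z z'. z \<noteq> z' \<Longrightarrow> g z z' \<in> \<A> \<and> 0 < g z z' (z - z')"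
    by metis
  define F where "F = insert p ((\<lambda>(z, z'). g z z') ` {(z, z') \<in> Z \<times> Z. z \<noteq> z'})"
  show thesis
  proof (rule that)
    have "{(z, z') \<in> Z \<times> Z. z \<noteq> z'} \<subseteq> Z \<times> Z"
      by blast
    then have "finite {(z, z') \<in> Z \<times> Z. z \<noteq> z'}"
      using Z finite_subset by blast
    then show fin: "finite F"
      by (simp add: F_def)
    show sub: "F \<subseteq> \<A>" and "p \<in> F"
      using g p by (auto simp: F_def)
    show "0 < (\<Sum>p\<in>F. p (z - z'))" if "z \<in> Z" "z' \<in> Z" "z \<noteq> z'" for z z'
    proof (rule sum_pos2[OF fin])
      show "g z z' \<in> F"
        using that by (auto simp: F_def)
      show "0 < g z z' (z - z')"
        using g that by blast
      show "0 \<le> p (z - z')" if "p \<in> F" for p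
        using that sub sn is_seminormD(1) by blast
    qed
  qed
qed

lemma C_all_sum_seminorms:
  assumes sn: "\<forall>p\<in>\<A>. is_seminorm smul p" and f: "f \<in> C_all \<Omega> \<A>" and F: "finite F" "F \<subseteq> \<A>"
  shows "continuous_map \<Omega> euclideanreal (\<lambda>s. \<Sum>p\<in>F. p (f s - y))"
  using f F unfolding C_all_def mem_Collect_eq continuous_map_seminorm_topology[OF sn]
  by (intro continuous_map_sum) auto

text \<open>If a sum of \<open>card F\<close> terms reaches \<open>d\<close>, some term reaches
  \<open>d / card F\<close>. So the set is a closed subset of a finite union of compact superlevel
  sets.\<close>

lemma C_0_compactin_sum_seminorms:
  assumes sn: "\<forall>p\<in>\<A>. is_seminorm smul p" and f: "f \<in> C_0 \<Omega> \<A>" and F: "finite F" "F \<subseteq> \<A>"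
    and d: "0 < d"
  shows "compactin \<Omega> {s \<in> topspace \<Omega>. d \<le> (\<Sum>p\<in>F. p (f s))}"
proof (cases "F = {}")
  case True
  then show ?thesis using d by simp
next
  case False
  define d' where "d' = d / card F"
  have d': "0 < d'" "d = card F * d'"
    using False F d by (auto simp: d'_def card_gt_0_iff)
  let ?K = "\<Union>p\<in>F. {s \<in> topspace \<Omega>. d' \<le> p (f s)}"
  show ?thesis
  proof (rule closed_compactin)
    show "compactin \<Omega> ?K"
      using F f d' by (intro compactin_Union) (auto simp: C_0_def)
    have "continuous_map \<Omega> euclideanreal (\<lambda>s. \<Sum>p\<in>F. p (f s - 0))"
      using f by (intro C_all_sum_seminorms[OF sn] F) (simp add: C_0_def)
    then have "closedin \<Omega> {s \<in> topspace \<Omega>. (\<Sum>p\<in>F. p (f s)) \<in> {d..}}"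
      by (intro closedin_continuous_map_preimage[where Y = euclideanreal]) auto
    then show "closedin \<Omega> {s \<in> topspace \<Omega>. d \<le> (\<Sum>p\<in>F. p (f s))}"
      by simp
    show "{s \<in> topspace \<Omega>. d \<le> (\<Sum>p\<in>F. p (f s))} \<subseteq> ?K"
    proof (intro subsetI, rule ccontr)
      fix s assume s: "s \<in> {s \<in> topspace \<Omega>. d \<le> (\<Sum>p\<in>F. p (f s))}" "s \<notin> ?K"
      then have "(\<Sum>p\<in>F. p (f s)) < card F * d'"
        using False F by (intro sum_bounded_above_strict) (auto simp: card_gt_0_iff not_le)
      then show False
        using s d' by simp
    qed
  qed
qed

section \<open>Approximation by compactly supported functions\<close>

text \<open>A single continuous \<open>w\<close> above \<open>v\<close> replaces the two families.
  The constants are chosen in the order \<open>M1\<close>, \<open>d\<close>, \<open>M2\<close>: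
  \<open>M1\<close> makes the value \<open>0\<close> acceptable where \<open>q (f s) < d\<close>,
  and \<open>M2\<close> bounds \<open>w\<close> wherever a nonzero value may be active.\<close>

lemma tensor_C_c_approximation:
  assumes sn: "\<forall>p\<in>\<A>. is_seminorm smul p" and H: "Hausdorff_space (seminorm_topology \<A>)"
    and T: "finite T" "T \<subseteq> topspace \<Omega>"
    and f: "f \<in> C_0 \<Omega> \<A>" and \<epsilon>: "0 < \<epsilon>" and p: "p \<in> \<A>"
    and w: "w \<in> C_nonneg \<Omega>" and wf: "compactin \<Omega> {s \<in> topspace \<Omega>. \<epsilon> / 2 \<le> w s * p (f s)}"
    and v: "\<And>s. s \<in> topspace \<Omega> \<Longrightarrow> v s \<le> w s"
  shows "\<exists>u \<in> tensor smul (C_c \<Omega> {cmod}).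
             weighted_seminorm \<Omega> v p (f - u) < ennreal \<epsilon> \<and>
             (\<forall>t\<in>T. u t = f t) \<and>
             u ` topspace \<Omega> \<subseteq> closed_convex_hull smul \<A> (f ` topspace \<Omega> \<union> {0}) \<and>
             supp \<Omega> u \<subseteq> supp \<Omega> f"
proof -
  define Z where "Z = insert 0 (f ` T)"
  have Z: "finite Z" "0 \<in> Z"
    using T by (auto simp: Z_def)
  obtain F where F: "finite F" "F \<subseteq> \<A>" "p \<in> F"
    and sepF: "\<And>z z'. z \<in> Z \<Longrightarrow> z' \<in> Z \<Longrightarrow> z \<noteq> z' \<Longrightarrow> 0 < (\<Sum>p\<in>F. p (z - z'))"
    using finite_separating_seminorms[OF sn H Z(1) p] by blast
  define q where "q x = (\<Sum>p\<in>F. p x)" for x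
  have snF: "is_seminorm smul p" if "p \<in> F" for p
    using that F sn by blast
  have snq: "is_seminorm smul q"
    unfolding q_def by (rule is_seminorm_sum[OF snF])
  have snp: "is_seminorm smul p"
    using sn p by blast
  have pq: "p x \<le> q x" for x
    unfolding q_def using F is_seminormD(1)[OF snF] by (intro member_le_sum) auto
  have fC: "f \<in> C_all \<Omega> \<A>"
    using f by (simp add: C_0_def)
  have cont: "continuous_map \<Omega> euclideanreal (\<lambda>s. q (f s - y))" for y
    unfolding q_def by (rule C_all_sum_seminorms[OF sn fC F(1,2)])
  have cont0: "continuous_map \<Omega> euclideanreal (\<lambda>s. q (f s))"
    using cont[of 0] by simp
  have wC: "continuous_map \<Omega> euclideanreal w" and w0: "\<And>s. s \<in> topspace \<Omega> \<Longrightarrow> 0 \<le> w s"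
    using w by (auto simp: C_nonneg_def)
  obtain M1 where M1: "0 < M1" "\<And>s. s \<in> {s \<in> topspace \<Omega>. \<epsilon> / 2 \<le> w s * p (f s)} \<Longrightarrow> w s \<le> M1"
    using compactin_bounded_above[OF wf wC] by blast
  \<comment> \<open>Where \<open>w s * p (f s) \<ge> \<epsilon> / 2\<close> the weight is at most \<open>M1\<close>, so \<open>q (f s) \<ge> d\<close> there.\<close>
  define d where "d = Min (insert (\<epsilon> / 2 / M1) (q ` (Z - {0})))"
  have d: "0 < d" "d \<le> \<epsilon> / 2 / M1" "\<And>z. z \<in> Z \<Longrightarrow> z \<noteq> 0 \<Longrightarrow> d \<le> q z"
  proof -
    have "0 < q z" if "z \<in> Z" "z \<noteq> 0" for z
      using sepF[of z 0] that Z by (simp add: q_def)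
    then show "0 < d"
      using Z \<epsilon> M1(1) by (auto simp: d_def)
    show "d \<le> \<epsilon> / 2 / M1" "\<And>z. z \<in> Z \<Longrightarrow> z \<noteq> 0 \<Longrightarrow> d \<le> q z"
      using Z unfolding d_def by (auto intro: Min_le)
  qed
  have small: "w s * p (f s) \<le> \<epsilon> / 2" if "s \<in> topspace \<Omega>" "q (f s) < d" for s
  proof (rule ccontr)
    assume "\<not> ?thesis"
    then have "\<epsilon> / 2 < w s * p (f s)" by simp
    also have "\<dots> \<le> M1 * p (f s)"
      using M1(2)[of s] calculation that is_seminormD(1)[OF snp] by (intro mult_right_mono) auto
    finally have "\<epsilon> / 2 / M1 < p (f s)"
      using M1(1) by (simp add: field_simps)
    then show False
      using d(2) pq[of "f s"] that by linarith
  qed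
  have compact_q: "compactin \<Omega> {s \<in> topspace \<Omega>. c \<le> q (f s)}" if "0 < c" for c
    unfolding q_def by (rule C_0_compactin_sum_seminorms[OF sn f F(1,2) that])
  have closed_q: "closedin \<Omega> {s \<in> topspace \<Omega>. c \<le> q (f s)}" for c
    using closedin_continuous_map_preimage[OF cont0, of "{c..}"] by simp
  \<comment> \<open>\<open>T\<close> is added so that on it every positive weight, including that of
    \<open>0\<close>, comes from a bump.\<close>
  define L where "L = {s \<in> topspace \<Omega>. d \<le> q (f s)} \<union> T"
  have L: "compactin \<Omega> L"
    unfolding L_def using d(1) T by (intro compactin_Un compact_q finite_imp_compactin)
  have d2: "0 < d / 2"
    using d(1) by simp
  \<comment> \<open>The level is \<open>d / 2\<close> rather than \<open>d\<close>, because a bump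
    around a value \<open>y\<close> with \<open>q y \<ge> d\<close> may reach down to
    \<open>q (f s) = d / 2\<close>.\<close>
  obtain M2 where M2: "0 < M2" "\<And>s. s \<in> {s \<in> topspace \<Omega>. d / 2 \<le> q (f s)} \<Longrightarrow> w s \<le> M2"
    using compactin_bounded_above[OF compact_q[OF d2] wC] by blast
  have \<eta>: "0 < \<epsilon> / 2 / M2"
    using \<epsilon> M2(1) by simp
  obtain Y \<psi> where Y: "finite Y" "Y \<subseteq> f ` L \<union> Z"
    and cont_\<psi>: "\<And>y. y \<in> Y \<Longrightarrow> continuous_map \<Omega> euclideanreal (\<psi> y)"
    and \<psi>0: "\<And>y s. y \<in> Y \<Longrightarrow> 0 \<le> \<psi> y s" and \<psi>1: "\<And>s. (\<Sum>y\<in>Y. \<psi> y s) = 1"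
    and near: "\<And>y s. y \<in> Y \<Longrightarrow> s \<in> topspace \<Omega> \<Longrightarrow> 0 < \<psi> y s \<Longrightarrow>
      q (f s - y) < \<epsilon> / 2 / M2 \<or> (y = 0 \<and> s \<notin> L)"
    and pos: "\<And>y z. y \<in> Y \<Longrightarrow> z \<in> Z \<Longrightarrow> y \<noteq> z \<Longrightarrow> 0 < q (y - z)"
    and away: "\<And>y z s. y \<in> Y \<Longrightarrow> z \<in> Z \<Longrightarrow> y \<noteq> z \<Longrightarrow> s \<in> topspace \<Omega> \<Longrightarrow> 0 < \<psi> y s \<Longrightarrow> y \<noteq> 0 \<or> s \<in> L \<Longrightarrow>
      q (y - z) \<le> 2 * q (f s - z)"
    using separating_partition[OF snq cont L Z sepF[folded q_def] \<eta>] by blast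
  have large: "d / 2 \<le> q (f s)" if "y \<in> Y" "y \<noteq> 0" "s \<in> topspace \<Omega>" "0 < \<psi> y s" for y s
  proof -
    \<comment> \<open>A nonzero \<open>y\<close> is a value on \<open>{q \<circ> f \<ge> d}\<close>
      or a point of \<open>Z\<close>; both have \<open>q y \<ge> d\<close>.\<close>
    have "d \<le> q y"
      using that Y(2) d(3) by (auto simp: L_def Z_def)
    also have "q y \<le> 2 * q (f s)"
      using away[of y 0 s] that Z by simp
    finally show ?thesis by simp
  qed
  \<comment> \<open>Below level \<open>d / 2\<close> only \<open>y = 0\<close> is active, and
    \<open>small\<close> applies. Above it, \<open>y\<close> is near \<open>f s\<close> and
    \<open>w s \<le> M2\<close>, or \<open>y = 0\<close> and \<open>s\<close> lies outside
    \<open>L\<close>, where again \<open>q (f s) < d\<close>.\<close>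
  have err: "w s * p (f s - y) \<le> \<epsilon> / 2" if y: "y \<in> Y" and s: "s \<in> topspace \<Omega>" and \<psi>: "0 < \<psi> y s" for y s
  proof -
    have *: ?thesis if "y = 0" "q (f s) < d"
      using small[OF s that(2)] that(1) by simp
    show ?thesis
    proof (cases "q (f s) < d / 2")
      case True
      then show ?thesis
        using * large[OF y _ s \<psi>] d(1) by fastforce
    next
      case False
      from near[OF y s \<psi>] show ?thesis
      proof
        assume "q (f s - y) < \<epsilon> / 2 / M2"
        then have "p (f s - y) \<le> \<epsilon> / 2 / M2"
          using pq[of "f s - y"] by simp
        then have "w s * p (f s - y) \<le> M2 * (\<epsilon> / 2 / M2)"
          using M2 False s is_seminormD(1)[OF snp] by (intro mult_mono) auto
        then show ?thesis
          using M2(1) by simp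
      next
        assume "y = 0 \<and> s \<notin> L"
        then show ?thesis
          using * s by (auto simp: L_def)
      qed
    qed
  qed
  define u where "u s = (\<Sum>y\<in>Y. smul (complex_of_real (\<psi> y s)) y)" for s
  \<comment> \<open>Covers two uses: points of \<open>T\<close> lie in \<open>L\<close>, and at
    zeros of \<open>f\<close> an active \<open>y \<noteq> f s\<close> is nonzero, so
    \<open>away\<close> applies either way.\<close>
  have interp: "u s = f s" if s: "s \<in> topspace \<Omega>" "f s \<in> Z" "f s = 0 \<or> s \<in> L" for s
    unfolding u_def
  proof (rule convex_combination_eq[OF Y(1) \<psi>1])
    fix y assume y: "y \<in> Y" "\<psi> y s \<noteq> 0"
    then have "0 < \<psi> y s" using \<psi>0[of y s] by simp
    then show "y = f s"
      using away[of y "f s" s] pos[of y "f s"] y s seminorm_zero[OF snq] by fastforce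
  qed
  \<comment> \<open>The term of \<open>0\<close> must go, since its weight carries the mass outside
    \<open>L\<close> and need not have compact support.\<close>
  have "u = (\<lambda>s. \<Sum>y\<in>Y - {0}. smul (complex_of_real (\<psi> y s)) y)"
    unfolding u_def using Y(1) by (intro ext sum.mono_neutral_right) auto
  moreover have "(\<lambda>s. complex_of_real (\<psi> y s)) \<in> C_c \<Omega> {cmod}" if "y \<in> Y - {0}" for y
  proof -
    have "compactin \<Omega> (supp \<Omega> (\<lambda>s. complex_of_real (\<psi> y s)))"
    proof (rule compactin_supp[OF compact_q[OF d2] closed_q])
      fix s assume "s \<in> topspace \<Omega>" "complex_of_real (\<psi> y s) \<noteq> 0"
      then show "s \<in> {s \<in> topspace \<Omega>. d / 2 \<le> q (f s)}"
        using large[of y s] \<psi>0[of y s] that by simp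
    qed
    then show ?thesis
      using that continuous_map_of_real[OF cont_\<psi>] by (simp add: C_c_def C_all_def seminorm_topology_cmod)
  qed
  ultimately have "u \<in> tensor smul (C_c \<Omega> {cmod})"
    by (simp only: tensor_sum)
  moreover have "weighted_seminorm \<Omega> v p (f - u) < ennreal \<epsilon>"
  proof (rule weighted_seminorm_less[OF \<epsilon>])
    fix s assume s: "s \<in> topspace \<Omega>"
    have "v s * p ((f - u) s) \<le> w s * p (f s - u s)"
      using v[OF s] is_seminormD(1)[OF snp] by (simp add: mult_right_mono)
    also have "\<dots> \<le> \<epsilon> / 2"
      unfolding u_def using err s by (intro convex_combination_dist_le[OF snp Y(1) \<psi>0 \<psi>1 w0])
    finally show "v s * p ((f - u) s) \<le> \<epsilon> / 2" .
  qed
  moreover have "\<forall>t\<in>T. u t = f t"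
    using T interp by (auto simp: Z_def L_def)
  moreover have "u ` topspace \<Omega> \<subseteq> closed_convex_hull smul \<A> (f ` topspace \<Omega> \<union> {0})"
  proof -
    have "Y \<subseteq> f ` topspace \<Omega> \<union> {0}"
      using Y(2) T by (auto simp: L_def Z_def)
    then show ?thesis
      unfolding u_def using convex_combination_in_hull[OF Y(1) _ \<psi>0 \<psi>1] by blast
  qed
  moreover have "supp \<Omega> u \<subseteq> supp \<Omega> f"
  proof (rule supp_subset[OF closedin_supp])
    fix s assume "s \<in> topspace \<Omega>" "u s \<noteq> 0"
    then show "s \<in> supp \<Omega> f"
      using interp[of s] Z(2) by (intro in_supp) auto
  qed
  ultimately show ?thesis by blast
qed

section \<open>Approximation by bounded functions under a weight vanishing at infinity\<close>

text \<open>Off \<open>L\<close> the weight is small and \<open>p \<circ> f\<close> is bounded, so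
  any value of \<open>f\<close> serves as default \<open>y0\<close>. Its coefficient only has to be
  bounded, hence its term may stay and the hull needs no extra \<open>0\<close>.\<close>

lemma tensor_C_b_approximation:
  assumes sn: "\<forall>p\<in>\<A>. is_seminorm smul p" and H: "Hausdorff_space (seminorm_topology \<A>)"
    and T: "finite T" "T \<subseteq> topspace \<Omega>"
    and f: "f \<in> C_b \<Omega> \<A>" and \<epsilon>: "0 < \<epsilon>" and p: "p \<in> \<A>" and v: "v \<in> C_0_nonneg \<Omega>"
  shows "\<exists>u \<in> tensor smul (C_b \<Omega> {cmod}).
             weighted_seminorm \<Omega> v p (f - u) < ennreal \<epsilon> \<and>
             (\<forall>t\<in>T. u t = f t) \<and>
             u ` topspace \<Omega> \<subseteq> closed_convex_hull smul \<A> (f ` topspace \<Omega>) \<and>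
             supp \<Omega> u \<subseteq> supp \<Omega> f"
proof (cases "topspace \<Omega> = {}")
  case True
  \<comment> \<open>\<open>y0\<close> has to be a value of \<open>f\<close>, so the empty space is
    treated separately with \<open>u = 0\<close>.\<close>
  have "(\<lambda>s. 0) \<in> tensor smul (C_b \<Omega> {cmod})"
    using tensor_sum[of "{}"] by simp
  then show ?thesis
    using True \<epsilon> T by (intro bexI[of _ "\<lambda>s. 0"]) (auto simp: weighted_seminorm_def supp_def bot_ennreal)
next
  case False
  then obtain s0 where s0: "s0 \<in> topspace \<Omega>" "f s0 = 0 \<or> (\<forall>s\<in>topspace \<Omega>. f s \<noteq> 0)"
    by blast
  define y0 where "y0 = f s0"
  define Z where "Z = insert y0 (f ` T)"
  have Z: "finite Z" "y0 \<in> Z"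
    using T by (auto simp: Z_def)
  obtain F where F: "finite F" "F \<subseteq> \<A>" "p \<in> F"
    and sepF: "\<And>z z'. z \<in> Z \<Longrightarrow> z' \<in> Z \<Longrightarrow> z \<noteq> z' \<Longrightarrow> 0 < (\<Sum>p\<in>F. p (z - z'))"
    using finite_separating_seminorms[OF sn H Z(1) p] by blast
  define q where "q x = (\<Sum>p\<in>F. p x)" for x
  have snF: "is_seminorm smul p" if "p \<in> F" for p
    using that F sn by blast
  have snq: "is_seminorm smul q"
    unfolding q_def by (rule is_seminorm_sum[OF snF])
  have snp: "is_seminorm smul p"
    using sn p by blast
  have pq: "p x \<le> q x" for x
    unfolding q_def using F is_seminormD(1)[OF snF] by (intro member_le_sum) auto
  have fC: "f \<in> C_all \<Omega> \<A>" and "bounded ((\<lambda>s. p (f s)) ` topspace \<Omega>)"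
    using f p by (auto simp: C_b_def)
  then obtain N where N: "0 < N" "\<And>x. x \<in> (\<lambda>s. p (f s)) ` topspace \<Omega> \<Longrightarrow> norm x \<le> N"
    unfolding bounded_pos by blast
  have pN: "p (f s) \<le> N" if "s \<in> topspace \<Omega>" for s
    using N(2)[of "p (f s)"] that by simp
  have cont: "continuous_map \<Omega> euclideanreal (\<lambda>s. q (f s - y))" for y
    unfolding q_def by (rule C_all_sum_seminorms[OF sn fC F(1,2)])
  have vC: "continuous_map \<Omega> euclideanreal v" and v0: "\<And>s. s \<in> topspace \<Omega> \<Longrightarrow> 0 \<le> v s"
    and compact_v: "\<And>c. 0 < c \<Longrightarrow> compactin \<Omega> {s \<in> topspace \<Omega>. c \<le> v s}"
    using v by (auto simp: C_0_nonneg_def C_nonneg_def)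
  obtain M where M: "0 < M" "\<And>s. s \<in> {s \<in> topspace \<Omega>. 1 \<le> v s} \<Longrightarrow> v s \<le> M"
    using compactin_bounded_above[OF compact_v[OF zero_less_one] vC] by blast
  have vM: "v s \<le> M + 1" if "s \<in> topspace \<Omega>" for s
    using M(1) M(2)[of s] that by (cases "1 \<le> v s") auto
  \<comment> \<open>\<open>2 * N\<close> bounds \<open>p (f s - y0)\<close>; hence off
    \<open>L\<close>, where \<open>v s < d\<close>, the weighted error is at most
    \<open>\<epsilon> / 2\<close>.\<close>
  define d where "d = \<epsilon> / 2 / (2 * N)"
  define L where "L = {s \<in> topspace \<Omega>. d \<le> v s} \<union> T"
  have L: "compactin \<Omega> L"
    unfolding L_def using \<epsilon> N(1) T
    by (intro compactin_Un compact_v finite_imp_compactin) (auto simp: d_def)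
  have \<eta>: "0 < \<epsilon> / 2 / (M + 1)"
    using \<epsilon> M(1) by simp
  obtain Y \<psi> where Y: "finite Y" "Y \<subseteq> f ` L \<union> Z"
    and cont_\<psi>: "\<And>y. y \<in> Y \<Longrightarrow> continuous_map \<Omega> euclideanreal (\<psi> y)"
    and \<psi>0: "\<And>y s. y \<in> Y \<Longrightarrow> 0 \<le> \<psi> y s" and \<psi>1: "\<And>s. (\<Sum>y\<in>Y. \<psi> y s) = 1"
    and near: "\<And>y s. y \<in> Y \<Longrightarrow> s \<in> topspace \<Omega> \<Longrightarrow> 0 < \<psi> y s \<Longrightarrow>
      q (f s - y) < \<epsilon> / 2 / (M + 1) \<or> (y = y0 \<and> s \<notin> L)"
    and pos: "\<And>y z. y \<in> Y \<Longrightarrow> z \<in> Z \<Longrightarrow> y \<noteq> z \<Longrightarrow> 0 < q (y - z)"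
    and away: "\<And>y z s. y \<in> Y \<Longrightarrow> z \<in> Z \<Longrightarrow> y \<noteq> z \<Longrightarrow> s \<in> topspace \<Omega> \<Longrightarrow> 0 < \<psi> y s \<Longrightarrow> y \<noteq> y0 \<or> s \<in> L \<Longrightarrow>
      q (y - z) \<le> 2 * q (f s - z)"
    using separating_partition[OF snq cont L Z sepF[folded q_def] \<eta>] by blast
  have err: "v s * p (f s - y) \<le> \<epsilon> / 2" if y: "y \<in> Y" and s: "s \<in> topspace \<Omega>" and \<psi>: "0 < \<psi> y s" for y s
    using near[OF y s \<psi>]
  proof
    assume "q (f s - y) < \<epsilon> / 2 / (M + 1)"
    then have "p (f s - y) \<le> \<epsilon> / 2 / (M + 1)"
      using pq[of "f s - y"] by simp
    then have "v s * p (f s - y) \<le> (M + 1) * (\<epsilon> / 2 / (M + 1))"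
      using vM[OF s] M(1) is_seminormD(1)[OF snp] by (intro mult_mono) auto
    also have "(M + 1) * (\<epsilon> / 2 / (M + 1)) = \<epsilon> / 2"
      using M(1) by (simp add: divide_simps)
    finally show ?thesis .
  next
    assume far: "y = y0 \<and> s \<notin> L"
    have "p (f s - y) \<le> p (f s) + p (f s0)"
      using seminorm_triangle[OF snp, of "f s" y 0] seminorm_uminus[OF snp, of y] far by (simp add: y0_def)
    then have "p (f s - y) \<le> 2 * N"
      using pN[OF s] pN[OF s0(1)] by simp
    then have "v s * p (f s - y) \<le> d * (2 * N)"
      using far s \<epsilon> N(1) is_seminormD(1)[OF snp] by (intro mult_mono) (auto simp: L_def d_def)
    then show ?thesis
      using N(1) by (simp add: d_def)
  qed
  define u where "u s = (\<Sum>y\<in>Y. smul (complex_of_real (\<psi> y s)) y)" for s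
  \<comment> \<open>As in the compactly supported case, with \<open>y0\<close> in the role of
    \<open>0\<close>.\<close>
  have interp: "u s = f s" if s: "s \<in> topspace \<Omega>" "f s \<in> Z" "f s = y0 \<or> s \<in> L" for s
    unfolding u_def
  proof (rule convex_combination_eq[OF Y(1) \<psi>1])
    fix y assume y: "y \<in> Y" "\<psi> y s \<noteq> 0"
    then have "0 < \<psi> y s" using \<psi>0[of y s] by simp
    then show "y = f s"
      using away[of y "f s" s] pos[of y "f s"] y s seminorm_zero[OF snq] by fastforce
  qed
  have "(\<lambda>s. complex_of_real (\<psi> y s)) \<in> C_b \<Omega> {cmod}" if y: "y \<in> Y" for y
  proof -
    have "\<psi> y s \<le> 1" for s
      using member_le_sum[of y Y "\<lambda>y. \<psi> y s"] \<psi>0 \<psi>1[of s] Y(1) y by simp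
    then have "bounded ((\<lambda>s. cmod (complex_of_real (\<psi> y s))) ` topspace \<Omega>)"
      using \<psi>0[OF y] by (intro boundedI[of _ 1]) auto
    then show ?thesis
      using y continuous_map_of_real[OF cont_\<psi>] by (simp add: C_b_def C_all_def seminorm_topology_cmod)
  qed
  then have "u \<in> tensor smul (C_b \<Omega> {cmod})"
    unfolding u_def by (simp add: tensor_sum)
  moreover have "weighted_seminorm \<Omega> v p (f - u) < ennreal \<epsilon>"
  proof (rule weighted_seminorm_less[OF \<epsilon>])
    fix s assume s: "s \<in> topspace \<Omega>"
    have "v s * p (f s - u s) \<le> \<epsilon> / 2"
      unfolding u_def using err s by (intro convex_combination_dist_le[OF snp Y(1) \<psi>0 \<psi>1 v0])
    then show "v s * p ((f - u) s) \<le> \<epsilon> / 2"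
      by simp
  qed
  moreover have "\<forall>t\<in>T. u t = f t"
    using T interp by (auto simp: Z_def L_def)
  moreover have "u ` topspace \<Omega> \<subseteq> closed_convex_hull smul \<A> (f ` topspace \<Omega>)"
  proof -
    have "Y \<subseteq> f ` topspace \<Omega>"
      using Y(2) T s0(1) by (auto simp: L_def Z_def y0_def)
    then show ?thesis
      unfolding u_def using convex_combination_in_hull[OF Y(1) _ \<psi>0 \<psi>1] by blast
  qed
  moreover have "supp \<Omega> u \<subseteq> supp \<Omega> f"
  proof (rule supp_subset[OF closedin_supp])
    fix s assume s: "s \<in> topspace \<Omega>" "u s \<noteq> 0"
    \<comment> \<open>The choice of \<open>s0\<close> makes \<open>y0 = 0\<close> as soon as
      \<open>f\<close> vanishes somewhere, so interpolation would force
      \<open>u s = 0\<close>.\<close>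
    have "f s \<noteq> 0"
    proof
      assume "f s = 0"
      then have "f s = y0"
        using s0(2) s(1) by (auto simp: y0_def)
      then show False
        using interp[of s] s Z(2) \<open>f s = 0\<close> by simp
    qed
    with s(1) show "s \<in> supp \<Omega> f"
      by (rule in_supp)
  qed
  ultimately show ?thesis by blast
qed

end

section \<open>Weighted, uniform and bounded versions together\<close>

theorem corollary3p15:
  fixes smul :: "complex \<Rightarrow> 'x::ab_group_add \<Rightarrow> 'x"
    and \<A> :: "('x \<Rightarrow> real) set"
    and \<Omega> :: "'a topology"
    and T\<^sub>0 :: "'a set"
  assumes "vector_space smul"
    and "\<forall>p\<in>\<A>. is_seminorm smul p"
    and "Hausdorff_space (seminorm_topology \<A>)"
    and "finite T\<^sub>0" and "T\<^sub>0 \<subseteq> topspace \<Omega>"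
  shows
    "(\<forall>V V'. nachbin_family \<Omega> V \<and> nachbin_family \<Omega> V' \<and> V' \<subseteq> C_nonneg \<Omega> \<and> nachbin_le \<Omega> V V' \<longrightarrow>
        tensor smul (C_c \<Omega> {cmod}) \<subseteq> CV_0 \<Omega> \<A> V \<and>
        (\<forall>f \<in> C_0 \<Omega> \<A> \<inter> CV_0 \<Omega> \<A> V'. \<forall>\<epsilon>>0. \<forall>v\<in>V. \<forall>p\<in>\<A>.
           \<exists>u \<in> tensor smul (C_c \<Omega> {cmod}).
             weighted_seminorm \<Omega> v p (f - u) < ennreal \<epsilon> \<and>
             (\<forall>t\<in>T\<^sub>0. u t = f t) \<and>
             u ` topspace \<Omega> \<subseteq> closed_convex_hull smul \<A> (f ` topspace \<Omega> \<union> {0}) \<and>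
             supp \<Omega> u \<subseteq> supp \<Omega> f))
     \<and> (tensor smul (C_c \<Omega> {cmod}) \<subseteq> CV_0 \<Omega> \<A> {\<lambda>_. 1} \<and>
        (\<forall>f \<in> C_0 \<Omega> \<A>. \<forall>\<epsilon>>0. \<forall>p\<in>\<A>.
           \<exists>u \<in> tensor smul (C_c \<Omega> {cmod}).
             weighted_seminorm \<Omega> (\<lambda>_. 1) p (f - u) < ennreal \<epsilon> \<and>
             (\<forall>t\<in>T\<^sub>0. u t = f t) \<and>
             u ` topspace \<Omega> \<subseteq> closed_convex_hull smul \<A> (f ` topspace \<Omega> \<union> {0}) \<and>
             supp \<Omega> u \<subseteq> supp \<Omega> f))
     \<and> (\<forall>f \<in> C_b \<Omega> \<A>. \<forall>\<epsilon>>0. \<forall>v \<in> C_0_nonneg \<Omega>. \<forall>p\<in>\<A>.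
           \<exists>u \<in> tensor smul (C_b \<Omega> {cmod}).
             weighted_seminorm \<Omega> v p (f - u) < ennreal \<epsilon> \<and>
             (\<forall>t\<in>T\<^sub>0. u t = f t) \<and>
             u ` topspace \<Omega> \<subseteq> closed_convex_hull smul \<A> (f ` topspace \<Omega>) \<and>
             supp \<Omega> u \<subseteq> supp \<Omega> f)"
proof -
  note vs = assms(1) and sn = assms(2) and H = assms(3) and T = assms(4,5)
  have sub: "tensor smul (C_c \<Omega> {cmod}) \<subseteq> CV_0 \<Omega> \<A> V" if "nachbin_family \<Omega> V" for V
    using tensor_C_c_subset_C_c[OF vs sn] C_c_subset_CV_0[OF vs sn that] by (rule subset_trans)
  have one: "nachbin_family \<Omega> {\<lambda>_. 1}"
  proof -
    have "openin \<Omega> {x \<in> topspace \<Omega>. 1 < a}" for a :: real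
      by (cases "1 < a") auto
    then show ?thesis
      by (simp add: nachbin_family_def upper_semicontinuous_on_top_def)
  qed
  show ?thesis
  proof (intro conjI allI impI ballI)
    fix V V' f \<epsilon> v p
    assume V: "nachbin_family \<Omega> V \<and> nachbin_family \<Omega> V' \<and> V' \<subseteq> C_nonneg \<Omega> \<and> nachbin_le \<Omega> V V'"
      and f: "f \<in> C_0 \<Omega> \<A> \<inter> CV_0 \<Omega> \<A> V'" and \<epsilon>: "0 < (\<epsilon>::real)" and v: "v \<in> V" and p: "p \<in> \<A>"
    obtain w where w: "w \<in> V'" "\<forall>s\<in>topspace \<Omega>. v s \<le> w s"
      using V v unfolding nachbin_le_def by blast
    show "\<exists>u \<in> tensor smul (C_c \<Omega> {cmod}).
             weighted_seminorm \<Omega> v p (f - u) < ennreal \<epsilon> \<and>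
             (\<forall>t\<in>T\<^sub>0. u t = f t) \<and>
             u ` topspace \<Omega> \<subseteq> closed_convex_hull smul \<A> (f ` topspace \<Omega> \<union> {0}) \<and>
             supp \<Omega> u \<subseteq> supp \<Omega> f"
    \<comment> \<open>The dominating \<open>w\<close> from \<open>V'\<close> is continuous, and
      \<open>f\<close> in \<open>CV_0 \<Omega> \<A> V'\<close> yields compactness at level
      \<open>\<epsilon> / 2\<close>.\<close>
    proof (rule tensor_C_c_approximation[OF vs sn H T _ \<epsilon> p])
      have "0 < \<epsilon> / 2"
        using \<epsilon> by simp
      then show "compactin \<Omega> {s \<in> topspace \<Omega>. \<epsilon> / 2 \<le> w s * p (f s)}"
        using f w(1) p unfolding CV_0_def by blast
    qed (use V f w in auto)
  next
    fix f \<epsilon> p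
    assume f: "f \<in> C_0 \<Omega> \<A>" and \<epsilon>: "0 < (\<epsilon>::real)" and p: "p \<in> \<A>"
    show "\<exists>u \<in> tensor smul (C_c \<Omega> {cmod}).
             weighted_seminorm \<Omega> (\<lambda>_. 1) p (f - u) < ennreal \<epsilon> \<and>
             (\<forall>t\<in>T\<^sub>0. u t = f t) \<and>
             u ` topspace \<Omega> \<subseteq> closed_convex_hull smul \<A> (f ` topspace \<Omega> \<union> {0}) \<and>
             supp \<Omega> u \<subseteq> supp \<Omega> f"
    proof (rule tensor_C_c_approximation[OF vs sn H T f \<epsilon> p])
      have "0 < \<epsilon> / 2"
        using \<epsilon> by simp
      \<comment> \<open>The factor \<open>1\<close> picks the constant weight \<open>w = 1\<close>,
        for which the condition is the one defining \<open>C_0\<close>.\<close>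
      then show "compactin \<Omega> {s \<in> topspace \<Omega>. \<epsilon> / 2 \<le> 1 * p (f s)}"
        using f p unfolding C_0_def mult_1 by blast
    qed (simp_all add: C_nonneg_def)
  qed (use sub one tensor_C_b_approximation[OF vs sn H T] in blast)+
qed

end
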